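(* Let $0<\ell<1$ and let $p\in(p_{\min},p_{\max})$. Then the limits $V_p:=\lim_{q\to p}V_{q,p}$ and $D_p:=\lim_{q\to p}D_{q,p}$ exist and $$V_p=\langle |\delta_\ell \mathbf u|^p\rangle\exp\Big\{-\frac{\langle|\delta_\ell \mathbf u|^p\ln|\delta_\ell \mathbf u|^p\rangle}{\langle|\delta_\ell \mathbf u|^p\rangle}\Big\}=\ell^{3-D_p},\qquad D_p=3-\zeta_p+p\,\zeta_p',$$ where $\zeta_p'=\frac{d}{dp}\zeta_p$. Moreover, with $h=\zeta_p'$, one has $D_p=d_h$, where $d_h:=\inf_{r}(3+hr-\zeta_r)$, the infimum being over all real $r$ for which $\zeta_r$ is finite.
   Context: $|\delta_\ell \mathbf u|$ is a nonnegative measurable real-valued function on a probability space $(\Omega,\mu)$ (the modulus of the velocity increment at the fixed scale $\ell$), and $\langle g\rangle=\int_\Omega g\,d\mu$. For $p\in\mathbb R$, $\zeta_p:=\log_\ell\langle|\delta_\ell \mathbf u|^p\rangle$, with conventions $|\delta_\ell \mathbf u|^0=1$ (so $\zeta_0=0$), $0^p=+\infty$ for $p<0$, $\log_\ell 0=+\infty$, $\log_\ell(+\infty)=-\infty$, and $0\cdot\ln 0=0$. Put $p_{\min}=\inf\{p\le 0:\zeta_p\text{ finite}\}$ and $p_{\max}=\sup\{p\ge0:\zeta_p\text{ finite}\}$. For $p\ne q$ in $(p_{\min},p_{\max})$, $$V_{q,p}=\frac{\langle|\delta_\ell \mathbf u|^q\rangle^{\frac{p}{p-q}}}{\langle|\delta_\ell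 \mathbf u|^p\rangle^{\frac{q}{p-q}}},\qquad D_{q,p}=3-\log_\ell V_{q,p}.$$ *)

theory Defs
  imports "HOL-Probability.Probability"
begin

text \<open>Throughout, \<open>M\<close> is the probability space, \<open>X\<close> is the modulus of the velocity increment at
  scale \<open>l\<close>, and moments take values in \<open>[0, \<infinity>]\<close>.\<close>

text \<open>Power of a nonnegative real with \<open>x^0 = 1\<close> (also for \<open>x = 0\<close>) and \<open>0^p = \<infinity>\<close> for \<open>p < 0\<close>;
  plain \<open>powr\<close> gives \<open>0\<close> in both cases. For \<open>p > 0\<close>, \<open>0 powr p = 0\<close> is the intended value.\<close>

definition epowr :: "real \<Rightarrow> real \<Rightarrow> ennreal" where
  "epowr x p = (if p = 0 then 1 else if x = 0 \<and> p < 0 then \<infinity> else ennreal (x powr p))"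

definition moment :: "'a measure \<Rightarrow> ('a \<Rightarrow> real) \<Rightarrow> real \<Rightarrow> ennreal" where
  "moment M X p = (\<integral>\<^sup>+ \<omega>. epowr (X \<omega>) p \<partial>M)"

text \<open>The conventions at \<open>0\<close> and \<open>\<infinity>\<close> are those for a base \<open>b < 1\<close>.\<close>

definition elog :: "real \<Rightarrow> ennreal \<Rightarrow> ereal" where
  "elog b y = (if y = 0 then \<infinity> else if y = \<infinity> then -\<infinity> else ereal (log b (enn2real y)))"

definition zeta :: "'a measure \<Rightarrow> ('a \<Rightarrow> real) \<Rightarrow> real \<Rightarrow> real \<Rightarrow> ereal" where
  "zeta M X l p = elog l (moment M X p)"

definition zeta_finite :: "'a measure \<Rightarrow> ('a \<Rightarrow> real) \<Rightarrow> real \<Rightarrow> real \<Rightarrow> bool" where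
  "zeta_finite M X l p \<longleftrightarrow> \<bar>zeta M X l p\<bar> \<noteq> \<infinity>"

definition p_min :: "'a measure \<Rightarrow> ('a \<Rightarrow> real) \<Rightarrow> real \<Rightarrow> ereal" where
  "p_min M X l = (INF p \<in> {p. p \<le> 0 \<and> zeta_finite M X l p}. ereal p)"

definition p_max :: "'a measure \<Rightarrow> ('a \<Rightarrow> real) \<Rightarrow> real \<Rightarrow> ereal" where
  "p_max M X l = (SUP p \<in> {p. p \<ge> 0 \<and> zeta_finite M X l p}. ereal p)"

text \<open>Only meaningful for \<open>q \<noteq> p\<close> in the open interval from \<open>p_min\<close> to \<open>p_max\<close>, where both moments
  are positive and finite.\<close>

definition V :: "'a measure \<Rightarrow> ('a \<Rightarrow> real) \<Rightarrow> real \<Rightarrow> real \<Rightarrow> real" where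
  "V M X q p = enn2real (moment M X q) powr (p / (p - q)) / enn2real (moment M X p) powr (q / (p - q))"

definition D :: "'a measure \<Rightarrow> ('a \<Rightarrow> real) \<Rightarrow> real \<Rightarrow> real \<Rightarrow> real \<Rightarrow> real" where
  "D M X l q p = 3 - log l (V M X q p)"

text \<open>The integrand \<open>y ln y\<close> with \<open>y = X^p\<close>. The convention \<open>0 ln 0 = 0\<close> holds since \<open>ln 0 = 0\<close>.
  The value \<open>y = \<infinity>\<close>, sent to \<open>0\<close> here, occurs only for \<open>p < 0\<close> where \<open>X\<close> vanishes, which is a
  null set as soon as the \<open>p\<close>-th moment is finite.\<close>

definition pow_ln_pow :: "('a \<Rightarrow> real) \<Rightarrow> real \<Rightarrow> 'a \<Rightarrow> real" where
  "pow_ln_pow X p \<omega> = (let y = enn2real (epowr (X \<omega>) p) in y * ln y)"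

definition d_spec :: "'a measure \<Rightarrow> ('a \<Rightarrow> real) \<Rightarrow> real \<Rightarrow> real \<Rightarrow> ereal" where
  "d_spec M X l h = (INF r \<in> {r. zeta_finite M X l r}. ereal (3 + h * r) - zeta M X l r)"

end

theory Submission
  imports Defs
begin

text \<open>
  On the open interval of finiteness the moment is \<open>m r = \<integral> X powr r\<close>, and everything follows from
  two properties of this function.

  First, \<open>m\<close> may be differentiated under the integral, with \<open>m' p = \<integral> X powr p * ln X\<close>
  (\<open>DERIV_integral_powr\<close>): near an interior \<open>p\<close> the logarithm costs only an arbitrarily small
  power, so the two outer moments dominate all difference quotients. Since
  \<open>ln V\<^sub>q\<^sub>,\<^sub>p = (p ln (m q) - q ln (m p)) / (p - q)\<close> equals \<open>ln (m p)\<close> minus \<open>p\<close> times the difference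
  quotient of \<open>ln m\<close>, it tends to \<open>ln (m p) - p m' p / m p\<close>, which is the asserted value because
  \<open>X powr p * ln (X powr p) = p * (X powr p * ln X)\<close>. Dividing by \<open>ln l\<close> gives \<open>D\<^sub>p\<close>.

  Second, \<open>ln m\<close> lies above its tangent at \<open>p\<close> (\<open>integral_powr_tangent\<close>). As \<open>ln l < 0\<close>, the
  function \<open>\<zeta>\<close> lies below its tangent, so \<open>3 + h r - \<zeta>\<^sub>r\<close> with \<open>h = \<zeta>'\<^sub>p\<close> is smallest at \<open>r = p\<close>,
  where it is \<open>D\<^sub>p\<close>.

  The value \<open>X = 0\<close> needs care, as \<open>0 powr r = 0\<close> disagrees with the conventions for \<open>r \<le> 0\<close>. The
  disagreement is harmless: if some moment of negative order is finite, then \<open>X\<close> vanishes only on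
  a null set, and otherwise the open interval contains positive orders only. At other orders of
  finiteness, such as \<open>r = 0\<close>, the true moment is at least \<open>\<integral> X powr r\<close>, which is the direction that
  the infimum requires.
\<close>

section \<open>Differentiating real powers under the integral\<close>

lemma powr_le_add_powr:
  fixes x a b r :: real
  assumes "a \<le> r" "r \<le> b"
  shows "x powr r \<le> x powr a + x powr b"
proof (cases "0 \<le> ln x")
  case True
  then have "x powr r \<le> x powr b"
    using assms by (cases "x = 0") (auto simp: powr_def intro!: mult_right_mono)
  then show ?thesis
    by (smt (verit) powr_ge_zero)
next
  case False
  then have "x powr r \<le> x powr a"
    using assms by (cases "x = 0") (auto simp: powr_def intro!: mult_right_mono_neg)
  then show ?thesis
    by (smt (verit) powr_ge_zero)
qed

text \<open>The gap \<open>d\<close> to the outer exponents absorbs the logarithm, since \<open>d \<bar>t\<bar> \<le> exp (d \<bar>t\<bar>)\<close> for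
  \<open>t = ln x\<close>.\<close>

lemma abs_ln_mult_powr_le:
  fixes x a b d s :: real
  assumes "0 \<le> x" "0 < d" "a + d \<le> s" "s \<le> b - d"
  shows "\<bar>x powr s * ln x\<bar> \<le> (x powr a + x powr b) / d"
proof (cases "x = 0")
  case False
  define t where "t = ln x"
  have pw: "x powr r = exp (r * t)" for r
    using False assms(1) by (simp add: powr_def t_def)
  have ineq: "d * u * exp v \<le> exp (d * u + v)" for u v :: real
    proof -
    have "d * u \<le> exp (d * u)"
      using exp_ge_add_one_self[of "d * u"] by linarith
    then show ?thesis
      by (simp add: exp_add)
  qed
  have "d * \<bar>exp (s * t) * t\<bar> \<le> exp (a * t) + exp (b * t)"
  proof (cases "0 \<le> t")
    case True
    have "d * t + s * t \<le> b * t"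
      using mult_right_mono[of "d + s" b t] assms True by (simp add: algebra_simps)
    then have "d * t * exp (s * t) \<le> exp (b * t)"
      using ineq[of t "s * t"] by (smt (verit) exp_le_cancel_iff)
    moreover have "0 \<le> exp (a * t)" by simp
    ultimately have "d * t * exp (s * t) \<le> exp (a * t) + exp (b * t)"
      by linarith
    then show ?thesis
      using True by (simp add: abs_mult mult_ac)
  next
    case f: False
    have "d * (- t) + s * t \<le> a * t"
      using mult_right_mono_neg[of a "s - d" t] assms f by (simp add: algebra_simps)
    then have "d * (- t) * exp (s * t) \<le> exp (a * t)"
      using ineq[of "- t" "s * t"] by (smt (verit) exp_le_cancel_iff)
    moreover have "0 \<le> exp (b * t)" by simp
    ultimately have "d * (- t) * exp (s * t) \<le> exp (a * t) + exp (b * t)"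
      by linarith
    then show ?thesis
      using f by (simp add: abs_mult mult_ac)
  qed
  then show ?thesis
    using assms(2) by (simp add: pw t_def[symmetric] field_simps)
qed simp

lemma integrable_powr_between:
  fixes X :: "'a \<Rightarrow> real"
  assumes [measurable]: "X \<in> borel_measurable M"
    and "integrable M (\<lambda>w. X w powr a)" "integrable M (\<lambda>w. X w powr b)"
    and "a \<le> r" "r \<le> b"
  shows "integrable M (\<lambda>w. X w powr r)"
proof (rule Bochner_Integration.integrable_bound)
  show "integrable M (\<lambda>w. X w powr a + X w powr b)"
    using assms by simp
qed (use powr_le_add_powr[OF assms(4,5)] in \<open>auto intro!: AE_I2 simp: abs_of_nonneg\<close>)

lemma integrable_powr_mult_ln:
  fixes X :: "'a \<Rightarrow> real"
  assumes [measurable]: "X \<in> borel_measurable M"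
    and nonneg: "\<And>w. w \<in> space M \<Longrightarrow> 0 \<le> X w"
    and int: "integrable M (\<lambda>w. X w powr a)" "integrable M (\<lambda>w. X w powr b)"
    and "a < p" "p < b"
  shows "integrable M (\<lambda>w. X w powr p * ln (X w))"
proof -
  define d where "d = min (p - a) (b - p)"
  have d: "0 < d" "a + d \<le> p" "p \<le> b - d"
    using assms by (auto simp: d_def)
  show ?thesis
  proof (rule Bochner_Integration.integrable_bound)
    show "integrable M (\<lambda>w. (X w powr a + X w powr b) / d)"
      using int by simp
    show "AE w in M. norm (X w powr p * ln (X w)) \<le> norm ((X w powr a + X w powr b) / d)"
      using abs_ln_mult_powr_le[OF nonneg d] d(1) by (auto intro!: AE_I2)
  qed simp
qed

lemma DERIV_powr_exponent:
  fixes x r :: real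
  shows "((\<lambda>q. x powr q) has_real_derivative x powr r * ln x) (at r within S)"
  by (cases "x = 0") (auto simp: powr_def intro!: derivative_eq_intros)

lemma DERIV_integral_powr:
  fixes X :: "'a \<Rightarrow> real"
  assumes [measurable]: "X \<in> borel_measurable M"
    and nonneg: "\<And>w. w \<in> space M \<Longrightarrow> 0 \<le> X w"
    and int: "integrable M (\<lambda>w. X w powr a)" "integrable M (\<lambda>w. X w powr b)"
    and "a < p" "p < b"
  shows "((\<lambda>r. \<integral>w. X w powr r \<partial>M) has_real_derivative (\<integral>w. X w powr p * ln (X w) \<partial>M)) (at p)"
proof -
  \<comment> \<open>Half the distance to the end points: orders within \<open>d\<close> of \<open>p\<close> keep a gap \<open>d\<close> to \<open>a\<close> and \<open>b\<close>.\<close>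
  define d where "d = min (p - a) (b - p) / 2"
  define S where "S = {p - d<..<p + d}"
  have d: "0 < d"
    using assms by (auto simp: d_def)
  have p: "p \<in> S"
    using d by (simp add: S_def)
  have S: "a + d \<le> s" "s \<le> b - d" if "s \<in> S" for s
    using that by (auto simp: S_def d_def min_def field_simps split: if_splits)
  have intS: "integrable M (\<lambda>w. X w powr s)" if "s \<in> S" for s
    using integrable_powr_between[OF assms(1) int] S[OF that] d by simp
  have quot: "\<bar>(X w powr q - X w powr p) / (q - p)\<bar> \<le> (X w powr a + X w powr b) / d"
    if w: "w \<in> space M" and q: "q \<in> S - {p}" for w q
  proof -
    have "norm (X w powr q - X w powr p) \<le> (X w powr a + X w powr b) / d * norm (q - p)"
    proof (rule field_differentiable_bound[where S = S])
      show "((\<lambda>q. X w powr q) has_field_derivative X w powr z * ln (X w)) (at z within S)" for z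
        by (rule DERIV_powr_exponent)
      show "norm (X w powr z * ln (X w)) \<le> (X w powr a + X w powr b) / d" if "z \<in> S" for z
        using abs_ln_mult_powr_le[OF nonneg[OF w] d S[OF that]] by simp
    qed (use p q in \<open>auto simp: S_def\<close>)
    then show ?thesis
      using q by (simp add: abs_divide pos_divide_le_eq del: times_divide_eq_left)
  qed
  have "((\<lambda>q. ((\<integral>w. X w powr q \<partial>M) - (\<integral>w. X w powr p \<partial>M)) / (q - p))
          \<longlongrightarrow> (\<integral>w. X w powr p * ln (X w) \<partial>M)) (at p within S)"
    unfolding tendsto_at_iff_sequentially comp_def
  proof (intro allI impI)
    fix s :: "nat \<Rightarrow> real"
    assume s: "\<forall>i. s i \<in> S - {p}" and lim: "s \<longlonglongrightarrow> p"
    have "(\<lambda>i. \<integral>w. (X w powr s i - X w powr p) / (s i - p) \<partial>M)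
            \<longlonglongrightarrow> (\<integral>w. X w powr p * ln (X w) \<partial>M)"
    proof (rule integral_dominated_convergence[where w = "\<lambda>w. (X w powr a + X w powr b) / d"])
      show "integrable M (\<lambda>w. (X w powr a + X w powr b) / d)"
        using int by simp
      show "AE w in M. (\<lambda>i. (X w powr s i - X w powr p) / (s i - p)) \<longlonglongrightarrow> X w powr p * ln (X w)"
      proof (rule AE_I2)
        fix w
        have "((\<lambda>q. (X w powr q - X w powr p) / (q - p)) \<longlongrightarrow> X w powr p * ln (X w)) (at p within S)"
          using DERIV_powr_exponent[of "X w" p S] by (simp add: has_field_derivative_iff)
        then show "(\<lambda>i. (X w powr s i - X w powr p) / (s i - p)) \<longlonglongrightarrow> X w powr p * ln (X w)"
          using s lim by (auto simp: tendsto_at_iff_sequentially comp_def)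
      qed
      show "AE w in M. norm ((X w powr s i - X w powr p) / (s i - p)) \<le> (X w powr a + X w powr b) / d" for i
        using quot s by (auto intro!: AE_I2)
    qed simp_all
    moreover have "(\<lambda>i. \<integral>w. (X w powr s i - X w powr p) / (s i - p) \<partial>M)
        = (\<lambda>i. ((\<integral>w. X w powr s i \<partial>M) - (\<integral>w. X w powr p \<partial>M)) / (s i - p))"
      using intS intS[OF p] s by (intro ext) simp
    ultimately show "(\<lambda>i. ((\<integral>w. X w powr s i \<partial>M) - (\<integral>w. X w powr p \<partial>M)) / (s i - p))
        \<longlonglongrightarrow> (\<integral>w. X w powr p * ln (X w) \<partial>M)"
      by (simp only:)
  qed
  moreover have "at p within S = at p"
    using p by (auto simp: S_def intro!: at_within_open)
  ultimately show ?thesis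
    by (simp add: has_field_derivative_iff)
qed

section \<open>The tangent inequality\<close>

text \<open>This is Jensen's inequality for \<open>exp\<close> under the probability measure with density proportional
  to \<open>X powr p\<close>: the tangent of \<open>exp\<close> at the mean value \<open>c\<close> of \<open>(r - p) * ln X\<close> is integrated
  against this density, and its linear part averages out.\<close>

lemma integral_powr_tangent:
  fixes X :: "'a \<Rightarrow> real"
  assumes nonneg: "\<And>w. w \<in> space M \<Longrightarrow> 0 \<le> X w"
    and intp: "integrable M (\<lambda>w. X w powr p)" and intln: "integrable M (\<lambda>w. X w powr p * ln (X w))"
    and intr: "integrable M (\<lambda>w. X w powr r)"
    and pos: "0 < (\<integral>w. X w powr p \<partial>M)"
  shows "(\<integral>w. X w powr p \<partial>M)
      * exp ((r - p) * ((\<integral>w. X w powr p * ln (X w) \<partial>M) / (\<integral>w. X w powr p \<partial>M)))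
    \<le> (\<integral>w. X w powr r \<partial>M)"
proof -
  define m where "m = (\<integral>w. X w powr p \<partial>M)"
  define m' where "m' = (\<integral>w. X w powr p * ln (X w) \<partial>M)"
  define c where "c = (r - p) * (m' / m)"
  have "(\<integral>w. exp c * ((1 - c) * X w powr p + (r - p) * (X w powr p * ln (X w))) \<partial>M)
      \<le> (\<integral>w. X w powr r \<partial>M)"
  proof (rule integral_mono)
    fix w assume w: "w \<in> space M"
    show "exp c * ((1 - c) * X w powr p + (r - p) * (X w powr p * ln (X w))) \<le> X w powr r"
    proof (cases "X w = 0")
      case False
      define u where "u = (r - p) * ln (X w)"
      have "X w powr r = X w powr p * exp u"
        using False by (simp add: powr_def u_def exp_add[symmetric] algebra_simps)
      also have "exp u = exp c * exp (u - c)"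
        by (simp add: exp_add[symmetric])
      finally have "X w powr r = X w powr p * (exp c * exp (u - c))" .
      moreover have "X w powr p * (exp c * (1 + (u - c))) \<le> X w powr p * (exp c * exp (u - c))"
        by (intro mult_left_mono exp_ge_add_one_self) simp_all
      ultimately show ?thesis
        by (simp add: u_def algebra_simps)
    qed simp
  qed (use intp intln intr in auto)
  also have "(\<integral>w. exp c * ((1 - c) * X w powr p + (r - p) * (X w powr p * ln (X w))) \<partial>M)
      = exp c * ((1 - c) * m + (r - p) * m')"
    using intp intln by (simp add: m_def m'_def)
  also have "\<dots> = m * exp c"
    using pos by (simp add: c_def m_def[symmetric] field_simps)
  finally show ?thesis
    by (simp add: c_def m_def m'_def)
qed

section \<open>Moments with the conventions at zero\<close>

lemma zeta_finite_iff:
  "zeta_finite M X l r \<longleftrightarrow> moment M X r \<noteq> 0 \<and> moment M X r \<noteq> \<infinity>"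
  by (simp add: zeta_finite_def zeta_def elog_def)

lemma zeta_eq_ln:
  assumes "zeta_finite M X l r"
  shows "zeta M X l r = ereal (ln (enn2real (moment M X r)) / ln l)"
  using assms by (simp add: zeta_finite_iff zeta_def elog_def log_def)

lemma ennreal_powr_le_epowr: "ennreal (x powr r) \<le> epowr x r"
  by (cases "x = 0") (auto simp: epowr_def)

lemma ennreal_powr_eq_epowr:
  assumes "0 < x \<or> 0 < r"
  shows "epowr x r = ennreal (x powr r)"
  using assms by (auto simp: epowr_def)

lemma borel_measurable_epowr [measurable]:
  assumes [measurable]: "X \<in> borel_measurable M"
  shows "(\<lambda>w. epowr (X w) r) \<in> borel_measurable M"
  unfolding epowr_def by measurable

lemma pow_ln_pow_eq:
  assumes "0 \<le> X w"
  shows "pow_ln_pow X p w = p * (X w powr p * ln (X w))"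
  using assms by (auto simp: pow_ln_pow_def epowr_def Let_def ln_powr)

lemma moment_finite_imp:
  assumes [measurable]: "X \<in> borel_measurable M"
    and fin: "moment M X r \<noteq> \<infinity>"
  shows integrable_powr_of_moment: "integrable M (\<lambda>w. X w powr r)"
    and integral_powr_le_moment: "(\<integral>w. X w powr r \<partial>M) \<le> enn2real (moment M X r)"
proof -
  have le: "(\<integral>\<^sup>+w. ennreal (X w powr r) \<partial>M) \<le> moment M X r"
    unfolding moment_def by (intro nn_integral_mono ennreal_powr_le_epowr)
  with fin have "(\<integral>\<^sup>+w. ennreal (X w powr r) \<partial>M) < \<infinity>"
    by (simp add: less_top top.not_eq_extremum order.strict_trans1)
  then show "integrable M (\<lambda>w. X w powr r)"
    by (intro integrableI_nonneg) auto
  have "(\<integral>w. X w powr r \<partial>M) = enn2real (\<integral>\<^sup>+w. ennreal (X w powr r) \<partial>M)"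
    by (rule integral_eq_nn_integral) auto
  with le fin show "(\<integral>w. X w powr r \<partial>M) \<le> enn2real (moment M X r)"
    by (simp add: enn2real_mono less_top)
qed

lemma moment_eq_integral_powr:
  assumes "AE w in M. 0 < X w \<or> 0 < r" "integrable M (\<lambda>w. X w powr r)"
  shows "moment M X r = ennreal (\<integral>w. X w powr r \<partial>M)"
proof -
  have "moment M X r = (\<integral>\<^sup>+w. ennreal (X w powr r) \<partial>M)"
    unfolding moment_def
    by (rule nn_integral_cong_AE) (use assms(1) in \<open>auto simp: ennreal_powr_eq_epowr\<close>)
  also have "\<dots> = ennreal (\<integral>w. X w powr r \<partial>M)"
    by (rule nn_integral_eq_integral) (use assms(2) in auto)
  finally show ?thesis .
qed

lemma AE_pos_of_moment_neg:
  assumes [measurable]: "X \<in> borel_measurable M"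
    and nonneg: "\<And>w. w \<in> space M \<Longrightarrow> 0 \<le> X w"
    and "moment M X a \<noteq> \<infinity>" "a < 0"
  shows "AE w in M. 0 < X w"
proof -
  have "AE w in M. epowr (X w) a \<noteq> \<infinity>"
    by (rule nn_integral_noteq_infinite) (use assms(3) in \<open>auto simp: moment_def\<close>)
  then show ?thesis
  proof (rule AE_mp, intro AE_I2 impI)
    fix w assume w: "w \<in> space M" and "epowr (X w) a \<noteq> \<infinity>"
    then have "X w \<noteq> 0"
      using \<open>a < 0\<close> by (auto simp: epowr_def)
    with nonneg[OF w] show "0 < X w" by simp
  qed
qed

text \<open>A random variable that vanishes almost surely has no finite \<open>\<zeta>\<^sub>r\<close> except at \<open>r = 0\<close>, so two
  different orders of finiteness exclude it.\<close>

lemma integral_powr_pos: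
  assumes "prob_space M" and X [measurable]: "X \<in> borel_measurable M"
    and nonneg: "\<And>w. w \<in> space M \<Longrightarrow> 0 \<le> X w"
    and a: "a \<le> 0" "zeta_finite M X l a" and b: "0 \<le> b" "zeta_finite M X l b" and "a < b"
    and intr: "integrable M (\<lambda>w. X w powr r)"
  shows "0 < (\<integral>w. X w powr r \<partial>M)"
proof (rule ccontr)
  interpret prob_space M by fact
  assume "\<not> 0 < (\<integral>w. X w powr r \<partial>M)"
  moreover have "0 \<le> (\<integral>w. X w powr r \<partial>M)"
    by (rule integral_nonneg_AE) simp
  ultimately have "(\<integral>w. X w powr r \<partial>M) = 0"
    by simp
  then have "AE w in M. X w powr r = 0"
    using intr by (subst (asm) integral_nonneg_eq_0_iff_AE) auto
  then have zero: "AE w in M. X w = 0"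
    by eventually_elim simp
  show False
  proof (cases "a < 0")
    case True
    have "AE w in M. 0 < X w"
      using AE_pos_of_moment_neg[OF X nonneg _ True] a by (simp add: zeta_finite_iff)
    with zero have "AE w in M. False"
      by eventually_elim simp
    then show False by simp
  next
    case False
    with a \<open>a < b\<close> have "0 < b" by simp
    from zero have "AE w in M. epowr (X w) b = 0"
      by eventually_elim (use \<open>0 < b\<close> in \<open>simp add: epowr_def\<close>)
    then have "moment M X b = 0"
      unfolding moment_def by (subst nn_integral_0_iff_AE) auto
    with b show False by (simp add: zeta_finite_iff)
  qed
qed

section \<open>The limits and the spectrum\<close>

theorem mainTheorem1:
  fixes M :: "'a measure" and X :: "'a \<Rightarrow> real" and l p :: real
  assumes "prob_space M"
    and "X \<in> borel_measurable M"
    and "\<And>\<omega>. \<omega> \<in> space M \<Longrightarrow> 0 \<le> X \<omega>"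
    and "0 < l" and "l < 1"
    and "p_min M X l < ereal p" and "ereal p < p_max M X l"
  shows "\<exists>Vp Dp zeta'.
      ((\<lambda>q. V M X q p) \<longlongrightarrow> Vp) (at p) \<and>
      ((\<lambda>q. D M X l q p) \<longlongrightarrow> Dp) (at p) \<and>
      ((\<lambda>r. real_of_ereal (zeta M X l r)) has_real_derivative zeta') (at p) \<and>
      integrable M (pow_ln_pow X p) \<and>
      Vp = enn2real (moment M X p) *
             exp (- ((\<integral>\<omega>. pow_ln_pow X p \<omega> \<partial>M) / enn2real (moment M X p))) \<and>
      Vp = l powr (3 - Dp) \<and>
      Dp = 3 - real_of_ereal (zeta M X l p) + p * zeta' \<and>
      ereal Dp = d_spec M X l zeta'"
proof -
  note X = assms(2) and nonneg = assms(3)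
  obtain a where a: "a \<le> 0" "zeta_finite M X l a" "a < p"
    using assms(6) by (auto simp: p_min_def INF_less_iff)
  obtain b where b: "0 \<le> b" "zeta_finite M X l b" "p < b"
    using assms(7) by (auto simp: p_max_def less_SUP_iff)
  define m where "m r = (\<integral>w. X w powr r \<partial>M)" for r
  define m' where "m' = (\<integral>w. X w powr p * ln (X w) \<partial>M)"
  have int_ab: "integrable M (\<lambda>w. X w powr a)" "integrable M (\<lambda>w. X w powr b)"
    using integrable_powr_of_moment[OF X] a b by (auto simp: zeta_finite_iff)
  have int: "integrable M (\<lambda>w. X w powr r)" if "a < r" "r < b" for r
    using integrable_powr_between[OF X int_ab] that by simp
  have int_ln: "integrable M (\<lambda>w. X w powr p * ln (X w))"
    by (rule integrable_powr_mult_ln[OF X nonneg int_ab]) (use a b in auto)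
  have m_pos: "0 < m r" if "a < r" "r < b" for r
    unfolding m_def
    by (rule integral_powr_pos[OF assms(1) X nonneg a(1,2) b(1,2) _ int[OF that]]) (use a b in auto)
  have mom: "moment M X r = ennreal (m r)" if "a < r" "r < b" for r
  proof -
    have "AE w in M. 0 < X w \<or> 0 < r"
    proof (cases "a < 0")
      case True
      have "AE w in M. 0 < X w"
        using AE_pos_of_moment_neg[OF X nonneg _ True] a by (simp add: zeta_finite_iff)
      then show ?thesis by eventually_elim simp
    qed (use a that in simp)
    then show ?thesis
      unfolding m_def using int[OF that] by (rule moment_eq_integral_powr)
  qed
  have fin: "zeta_finite M X l r" if "a < r" "r < b" for r
    using mom[OF that] m_pos[OF that] by (simp add: zeta_finite_iff)
  have zeta: "zeta M X l r = ereal (ln (m r) / ln l)" if "a < r" "r < b" for r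
    using zeta_eq_ln[OF fin[OF that]] mom[OF that] m_pos[OF that] by simp
  have p: "a < p" "p < b" by fact+
  have mp: "0 < m p" using m_pos p by simp
  have ln_l: "ln l < 0" using assms by simp
  have near: "eventually (\<lambda>q. a < q \<and> q < b) (nhds p)"
    using eventually_nhds_in_open[of "{a<..<b}" p] p by simp
  have near': "eventually (\<lambda>q. q \<noteq> p \<and> a < q \<and> q < b) (at p)"
    using near by (auto simp: eventually_at_filter elim: eventually_mono)

  have deriv: "((\<lambda>r. ln (m r)) has_real_derivative m' / m p) (at p)"
  proof -
    have "(m has_real_derivative m') (at p)"
      unfolding m_def m'_def by (rule DERIV_integral_powr[OF X nonneg int_ab p])
    then show ?thesis
      using mp by (auto intro!: derivative_eq_intros)
  qed
  define zeta' where "zeta' = m' / m p / ln l"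
  define lnV where "lnV = ln (m p) - p * (m' / m p)"
  define Dp where "Dp = 3 - lnV / ln l"

  have lim_V: "((\<lambda>q. V M X q p) \<longlongrightarrow> exp lnV) (at p)"
  proof -
    have "((\<lambda>q. (ln (m q) - ln (m p)) / (q - p)) \<longlongrightarrow> m' / m p) (at p)"
      using deriv by (simp add: has_field_derivative_iff)
    then have "((\<lambda>q. exp (ln (m p) - p * ((ln (m q) - ln (m p)) / (q - p)))) \<longlongrightarrow> exp lnV) (at p)"
      unfolding lnV_def by (intro tendsto_exp tendsto_diff tendsto_mult tendsto_const)
    moreover have "eventually (\<lambda>q. exp (ln (m p) - p * ((ln (m q) - ln (m p)) / (q - p))) = V M X q p) (at p)"
      using near'
    proof eventually_elim
      case (elim q)
      then have q: "a < q" "q < b" "q - p \<noteq> 0" "p - q \<noteq> 0" by auto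
      have mq: "0 < m q" using m_pos q by simp
      have "V M X q p = exp (p / (p - q) * ln (m q) - q / (p - q) * ln (m p))"
        using mq mp p q by (simp add: V_def mom powr_def exp_diff)
      also have "p / (p - q) * ln (m q) - q / (p - q) * ln (m p)
          = ln (m p) - p * ((ln (m q) - ln (m p)) / (q - p))"
        using q by (simp add: divide_simps) (simp add: algebra_simps)
      finally show ?case by simp
    qed
    ultimately show ?thesis
      by (rule Lim_transform_eventually)
  qed
  have lim_D: "((\<lambda>q. D M X l q p) \<longlongrightarrow> Dp) (at p)"
  proof -
    have "((\<lambda>q. 3 - ln (V M X q p) / ln l) \<longlongrightarrow> 3 - ln (exp lnV) / ln l) (at p)"
      using ln_l by (intro tendsto_intros lim_V) auto
    then show ?thesis by (simp add: D_def log_def Dp_def)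
  qed
  have d_zeta: "((\<lambda>r. real_of_ereal (zeta M X l r)) has_real_derivative zeta') (at p)"
  proof -
    have "((\<lambda>r. ln (m r) / ln l) has_real_derivative zeta') (at p)"
      unfolding zeta'_def by (rule DERIV_cdivide[OF deriv])
    moreover have "eventually (\<lambda>r. real_of_ereal (zeta M X l r) = ln (m r) / ln l) (nhds p)"
      using near by eventually_elim (simp add: zeta)
    ultimately show ?thesis
      by (subst DERIV_cong_ev) auto
  qed
  have int_pow: "integrable M (pow_ln_pow X p)"
    and pow: "(\<integral>w. pow_ln_pow X p w \<partial>M) = p * m'"
  proof -
    have "integrable M (\<lambda>w. p * (X w powr p * ln (X w)))"
      using int_ln by simp
    then show "integrable M (pow_ln_pow X p)"
      by (subst Bochner_Integration.integrable_cong[OF refl]) (use nonneg in \<open>auto simp: pow_ln_pow_eq\<close>)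
    have "(\<integral>w. pow_ln_pow X p w \<partial>M) = (\<integral>w. p * (X w powr p * ln (X w)) \<partial>M)"
      by (rule Bochner_Integration.integral_cong) (use nonneg in \<open>auto simp: pow_ln_pow_eq\<close>)
    then show "(\<integral>w. pow_ln_pow X p w \<partial>M) = p * m'"
      by (simp add: m'_def)
  qed
  have V_moment: "exp lnV = enn2real (moment M X p) *
      exp (- ((\<integral>w. pow_ln_pow X p w \<partial>M) / enn2real (moment M X p)))"
    using mp p by (simp add: mom pow lnV_def exp_diff exp_minus divide_inverse mult.assoc)
  have V_D: "exp lnV = l powr (3 - Dp)"
    using assms(4) ln_l by (simp add: Dp_def powr_def)
  have D_zeta: "Dp = 3 - real_of_ereal (zeta M X l p) + p * zeta'"
    using p by (simp add: Dp_def lnV_def zeta zeta'_def diff_divide_distrib)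

  have "d_spec M X l zeta' = ereal Dp"
    unfolding d_spec_def
  proof (rule antisym)
    have "ereal (3 + zeta' * p) - zeta M X l p = ereal Dp"
      using p by (simp add: D_zeta zeta algebra_simps)
    then show "(INF r\<in>{r. zeta_finite M X l r}. ereal (3 + zeta' * r) - zeta M X l r) \<le> ereal Dp"
      using fin[OF p] by (intro INF_lower2[of p]) auto
    show "ereal Dp \<le> (INF r\<in>{r. zeta_finite M X l r}. ereal (3 + zeta' * r) - zeta M X l r)"
    proof (rule INF_greatest)
      fix r assume "r \<in> {r. zeta_finite M X l r}"
      then have r: "zeta_finite M X l r" by simp
      define mr where "mr = enn2real (moment M X r)"
      have mr: "moment M X r \<noteq> \<infinity>"
        using r by (simp add: zeta_finite_iff)
      have "m p * exp ((r - p) * (m' / m p)) \<le> m r"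
        unfolding m_def m'_def
        by (rule integral_powr_tangent[OF nonneg int[OF p] int_ln integrable_powr_of_moment[OF X mr]])
          (use mp in \<open>auto simp: m_def\<close>)
      also have "m r \<le> mr"
        unfolding m_def mr_def by (rule integral_powr_le_moment[OF X mr])
      finally have le: "m p * exp ((r - p) * (m' / m p)) \<le> mr" .
      have "ln (m p) + (r - p) * (m' / m p) = ln (m p * exp ((r - p) * (m' / m p)))"
        using mp by (simp add: ln_mult)
      also have "\<dots> \<le> ln mr"
        using le mp by (intro ln_mono) auto
      finally have "ln mr / ln l \<le> (ln (m p) + (r - p) * (m' / m p)) / ln l"
        using ln_l by (intro divide_right_mono_neg) auto
      also have "\<dots> = 3 + zeta' * r - Dp"
        using ln_l by (simp add: zeta'_def Dp_def lnV_def add_divide_distrib diff_divide_distrib algebra_simps)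
      finally have "Dp \<le> 3 + zeta' * r - ln mr / ln l" by simp
      then show "ereal Dp \<le> ereal (3 + zeta' * r) - zeta M X l r"
        using zeta_eq_ln[OF r] by (simp add: mr_def)
    qed
  qed
  then show ?thesis
    using lim_V lim_D d_zeta int_pow V_moment V_D D_zeta by metis
qed

end
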